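(* Let $V\rightarrow M$ be a vector bundle, $D$ a connection on $V$ and $A\in\Omega^{1}(M,\mathrm{End}V)$ such that $$(d^{D}A)_{X,Y}:=D_{X}(A_{Y})-D_{Y}(A_{X})-A_{[X,Y]}=0\quad\text{and}\quad A_{X}A_{Y}=A_{Y}A_{X}$$ for any vector fields $X,Y\in\mathcal{X}(M)$. Let $u$ be a section of $V$ such that $$A_{Y}(D_{Z}u)=A_{Z}(D_{Y}u),\qquad\forall Y,Z\in\mathcal{X}(M).$$ Assume that the map $F:TM\rightarrow V$, $F(X):=A_{X}(u)$, is a bundle isomorphism. Then: i) The multiplication $$X\circ Y=F^{-1}\left(A_{X}A_{Y}u\right),\qquad X,Y\in\mathcal{X}(M)$$ is commutative, associative, with unit field $F^{-1}(u)$. ii) The pull-back connection $F^{*}D$ is torsion-free and compatible with $\circ$. In particular, $(M,\circ,F^{-1}(u))$ is an $F$-manifold.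
   Context: Everything is in the smooth category; $\mathcal{X}(M)$ denotes the vector fields on the manifold $M$, and $\Omega^{1}(M,\mathrm{End}V)$ the $1$-forms on $M$ with values in $\mathrm{End}V$. Here $D_{X}(A_{Y})$ is the covariant derivative of the endomorphism $A_{Y}$ with respect to the connection induced by $D$ on $\mathrm{End}V$. The pull-back connection $F^{*}D$ on $TM$ is $(F^{*}D)_{X}Y:=F^{-1}D_{X}(F(Y))$. $F$-manifold: a triple $(M,\circ,e)$ where $M$ is a manifold and $\circ$ is a fiber-preserving commutative, associative, bilinear multiplication on $TM$ with unit field $e$, such that $L_{X\circ Y}(\circ)=X\circ L_{Y}(\circ)+Y\circ L_{X}(\circ)$ for all $X,Y\in\mathcal{X}(M)$, where $L_{Z}(\circ)(X,Y)=[Z,X\circ Y]-[Z,X]\circ Y-X\circ[Z,Y]$. Compatible connection: a connection $\nabla$ on $TM$ is compatible with a commutative, associative multiplication $\circ$ on $TM$ if $\nabla_{X}(\circ)(Y,Z):=\nabla_{X}(Y\circ Z)-\nabla_{X}(Y)\circ Z-Y\circ\nabla_{X}(Z)$ is totally symmetric in $X,Y,Z$. *)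

theory Defs
  imports "HOL-Analysis.Analysis" "HOL-Library.Function_Algebras"
begin

text \<open>Pointwise scalar multiplication. With it, the functionals \<open>('m \<Rightarrow> real) \<Rightarrow> real\<close>, of which
  tangent vectors are examples, form a real vector space.\<close>

instantiation "fun" :: (type, scaleR) scaleR
begin
definition scaleR_fun :: "real \<Rightarrow> ('a \<Rightarrow> 'b) \<Rightarrow> 'a \<Rightarrow> 'b" where
  "scaleR_fun c f = (\<lambda>x. c *\<^sub>R f x)"
instance ..
end

instance "fun" :: (type, real_vector) real_vector
  by standard (simp_all add: scaleR_fun_def plus_fun_def fun_eq_iff
      scaleR_add_right scaleR_add_left)


section \<open>Smooth manifolds\<close>

text \<open>The model spaces are of sort \<open>{real_inner, heine_borel}\<close>. By Riesz' theorem on the compactness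
  of balls, these are exactly the finite-dimensional real inner product spaces. In contrast to
  \<open>euclidean_space\<close> the sort admits dimension \<open>0\<close>.

  The set \<open>S\<close> below is always open. In finite dimension, \<open>C\<^sup>k\<close> can be expressed by iterated
  directional derivatives.\<close>

primrec times_cont_differentiable_on ::
    "nat \<Rightarrow> 'a::real_normed_vector set \<Rightarrow> ('a \<Rightarrow> 'b::real_normed_vector) \<Rightarrow> bool" where
  "times_cont_differentiable_on 0 S f \<longleftrightarrow> continuous_on S f"
| "times_cont_differentiable_on (Suc k) S f \<longleftrightarrow>
     (\<forall>x\<in>S. f differentiable (at x)) \<and>
     (\<forall>v. times_cont_differentiable_on k S (\<lambda>x. frechet_derivative f (at x) v))"

definition smooth_on :: "'a::real_normed_vector set \<Rightarrow> ('a \<Rightarrow> 'b::real_normed_vector) \<Rightarrow> bool" where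
  "smooth_on S f \<longleftrightarrow> (\<forall>k. times_cont_differentiable_on k S f)"

text \<open>The manifold is the whole type \<open>'m\<close> with the topology of its type classes. Its smooth structure
  is given by an atlas \<open>M\<close>, not necessarily a maximal one.\<close>

type_synonym ('m, 'a) chart = "'m set \<times> ('m \<Rightarrow> 'a)"

definition smooth_manifold ::
    "('m::{t2_space, second_countable_topology}, 'a::{real_inner, heine_borel}) chart set \<Rightarrow> bool" where
  "smooth_manifold M \<longleftrightarrow>
     (\<forall>(U, c)\<in>M. open U \<and> open (c ` U) \<and> homeomorphism U (c ` U) c (inv_into U c)) \<and>
     (\<Union>(U, c)\<in>M. U) = UNIV \<and>
     (\<forall>(U, c)\<in>M. \<forall>(W, d)\<in>M. smooth_on (c ` (U \<inter> W)) (d \<circ> inv_into U c))"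

definition smooth_map_on ::
    "('m, 'a::real_normed_vector) chart set \<Rightarrow> 'm set \<Rightarrow> ('m \<Rightarrow> 'b::real_normed_vector) \<Rightarrow> bool" where
  "smooth_map_on M S f \<longleftrightarrow> (\<forall>(U, c)\<in>M. smooth_on (c ` (U \<inter> S)) (f \<circ> inv_into U c))"

definition smooth_functions :: "('m, 'a::real_normed_vector) chart set \<Rightarrow> ('m \<Rightarrow> real) set" where
  "smooth_functions M = {f. smooth_map_on M UNIV f}"


section \<open>Tangent vectors and vector fields\<close>

type_synonym 'm tangent_vector = "('m \<Rightarrow> real) \<Rightarrow> real"
type_synonym 'm vector_field = "'m \<Rightarrow> 'm tangent_vector"

text \<open>Tangent vectors at \<open>p\<close> are the derivations at \<open>p\<close> of the algebra of smooth functions. As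
  functionals on all functions \<open>'m \<Rightarrow> real\<close> they are made unique by the value \<open>0\<close> outside that
  algebra.\<close>

definition tangent_space :: "('m, 'a::real_normed_vector) chart set \<Rightarrow> 'm \<Rightarrow> 'm tangent_vector set" where
  "tangent_space M p = {v.
     (\<forall>f\<in>smooth_functions M. \<forall>g\<in>smooth_functions M. v (\<lambda>q. f q + g q) = v f + v g) \<and>
     (\<forall>c. \<forall>f\<in>smooth_functions M. v (\<lambda>q. c * f q) = c * v f) \<and>
     (\<forall>f\<in>smooth_functions M. \<forall>g\<in>smooth_functions M.
        v (\<lambda>q. f q * g q) = v f * g p + f p * v g) \<and>
     (\<forall>f. f \<notin> smooth_functions M \<longrightarrow> v f = 0)}"

definition vector_fields :: "('m, 'a::real_normed_vector) chart set \<Rightarrow> 'm vector_field set" where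
  "vector_fields M = {X. (\<forall>p. X p \<in> tangent_space M p) \<and>
     (\<forall>f\<in>smooth_functions M. (\<lambda>p. X p f) \<in> smooth_functions M)}"

text \<open>For \<open>f\<close> not smooth, both terms vanish by the convention above.\<close>

definition lie_bracket :: "'m vector_field \<Rightarrow> 'm vector_field \<Rightarrow> 'm vector_field" where
  "lie_bracket X Y = (\<lambda>p f. X p (\<lambda>q. Y q f) - Y p (\<lambda>q. X q f))"


section \<open>Vector bundles\<close>

definition linear_map_on :: "'v::real_vector set \<Rightarrow> ('v \<Rightarrow> 'w::real_vector) \<Rightarrow> bool" where
  "linear_map_on S f \<longleftrightarrow>
     (\<forall>x\<in>S. \<forall>y\<in>S. f (x + y) = f x + f y) \<and> (\<forall>c. \<forall>x\<in>S. f (c *\<^sub>R x) = c *\<^sub>R f x)"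

text \<open>A vector bundle has fibres \<open>E p\<close> and a bundle atlas \<open>\<Phi>\<close> of local trivializations \<open>(U, \<phi>)\<close>, where
  \<open>\<phi> p\<close> maps \<open>E p\<close> isomorphically to the model fibre. The total space is the disjoint union of the
  fibres, with the topology and the smooth structure determined by \<open>\<Phi>\<close>. The fibres are taken as
  subspaces of one real vector space \<open>'v\<close> only in order to share their operations: \<open>'v\<close> carries no
  topology, and any family of vector spaces embeds in its direct sum. As the model fibre has finite
  dimension, the transition functions are smooth iff they are so on each fixed vector \<open>w\<close>.\<close>

type_synonym ('m, 'v, 'k) trivialization = "'m set \<times> ('m \<Rightarrow> 'v \<Rightarrow> 'k)"

definition vector_bundle ::
    "('m::{t2_space, second_countable_topology}, 'a::{real_inner, heine_borel}) chart set \<Rightarrow>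
     ('m \<Rightarrow> 'v::real_vector set) \<Rightarrow>
     ('m, 'v, 'k::{real_inner, heine_borel}) trivialization set \<Rightarrow> bool" where
  "vector_bundle M E \<Phi> \<longleftrightarrow>
     (\<forall>p. subspace (E p)) \<and>
     (\<forall>(U, \<phi>)\<in>\<Phi>. open U \<and> (\<forall>p\<in>U. linear_map_on (E p) (\<phi> p) \<and> bij_betw (\<phi> p) (E p) UNIV)) \<and>
     (\<Union>(U, \<phi>)\<in>\<Phi>. U) = UNIV \<and>
     (\<forall>(U, \<phi>)\<in>\<Phi>. \<forall>(W, \<psi>)\<in>\<Phi>. \<forall>w.
        smooth_map_on M (U \<inter> W) (\<lambda>p. \<psi> p (inv_into (E p) (\<phi> p) w)))"

definition smooth_sections ::
    "('m, 'a::real_normed_vector) chart set \<Rightarrow> ('m \<Rightarrow> 'v set) \<Rightarrow>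
     ('m, 'v, 'k::real_normed_vector) trivialization set \<Rightarrow> ('m \<Rightarrow> 'v) set" where
  "smooth_sections M E \<Phi> = {s. (\<forall>p. s p \<in> E p) \<and>
     (\<forall>(U, \<phi>)\<in>\<Phi>. smooth_map_on M U (\<lambda>p. \<phi> p (s p)))}"

text \<open>The notions below are used for \<open>V\<close> as well as for the tangent bundle. They refer to a bundle by
  its fibres \<open>E\<close> and its set \<open>\<Gamma>\<close> of smooth sections; for the tangent bundle these are
  \<open>tangent_space M\<close> and \<open>vector_fields M\<close>. Since sections can be prescribed locally, a fibrewise linear
  map is smooth iff it maps smooth sections to smooth sections.\<close>

definition bundle_hom ::
    "('m \<Rightarrow> 'v::real_vector set) \<Rightarrow> ('m \<Rightarrow> 'v) set \<Rightarrow>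
     ('m \<Rightarrow> 'w::real_vector set) \<Rightarrow> ('m \<Rightarrow> 'w) set \<Rightarrow> ('m \<Rightarrow> 'v \<Rightarrow> 'w) \<Rightarrow> bool" where
  "bundle_hom E \<Gamma> E' \<Gamma>' F \<longleftrightarrow>
     (\<forall>p. linear_map_on (E p) (F p) \<and> F p ` E p \<subseteq> E' p) \<and>
     (\<forall>s\<in>\<Gamma>. (\<lambda>p. F p (s p)) \<in> \<Gamma>')"

definition bundle_inv :: "('m \<Rightarrow> 'v set) \<Rightarrow> ('m \<Rightarrow> 'v \<Rightarrow> 'w) \<Rightarrow> 'm \<Rightarrow> 'w \<Rightarrow> 'v" where
  "bundle_inv E F = (\<lambda>p. inv_into (E p) (F p))"

definition bundle_iso ::
    "('m \<Rightarrow> 'v::real_vector set) \<Rightarrow> ('m \<Rightarrow> 'v) set \<Rightarrow>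
     ('m \<Rightarrow> 'w::real_vector set) \<Rightarrow> ('m \<Rightarrow> 'w) set \<Rightarrow> ('m \<Rightarrow> 'v \<Rightarrow> 'w) \<Rightarrow> bool" where
  "bundle_iso E \<Gamma> E' \<Gamma>' F \<longleftrightarrow>
     bundle_hom E \<Gamma> E' \<Gamma>' F \<and> (\<forall>p. bij_betw (F p) (E p) (E' p)) \<and>
     bundle_hom E' \<Gamma>' E \<Gamma> (bundle_inv E F)"


section \<open>Connections\<close>

definition connection ::
    "('m, 'a::real_normed_vector) chart set \<Rightarrow> ('m \<Rightarrow> 'v::real_vector) set \<Rightarrow>
     ('m vector_field \<Rightarrow> ('m \<Rightarrow> 'v) \<Rightarrow> ('m \<Rightarrow> 'v)) \<Rightarrow> bool" where
  "connection M \<Gamma> D \<longleftrightarrow>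
     (\<forall>X\<in>vector_fields M. \<forall>s\<in>\<Gamma>. D X s \<in> \<Gamma>) \<and>
     (\<forall>X\<in>vector_fields M. \<forall>Y\<in>vector_fields M. \<forall>s\<in>\<Gamma>. D (X + Y) s = D X s + D Y s) \<and>
     (\<forall>f\<in>smooth_functions M. \<forall>X\<in>vector_fields M. \<forall>s\<in>\<Gamma>.
        D (\<lambda>p. f p *\<^sub>R X p) s = (\<lambda>p. f p *\<^sub>R D X s p)) \<and>
     (\<forall>X\<in>vector_fields M. \<forall>s\<in>\<Gamma>. \<forall>t\<in>\<Gamma>. D X (s + t) = D X s + D X t) \<and>
     (\<forall>f\<in>smooth_functions M. \<forall>X\<in>vector_fields M. \<forall>s\<in>\<Gamma>.
        D X (\<lambda>p. f p *\<^sub>R s p) = (\<lambda>p. X p f *\<^sub>R s p + f p *\<^sub>R D X s p))"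

definition torsion_free ::
    "('m, 'a::real_normed_vector) chart set \<Rightarrow>
     ('m vector_field \<Rightarrow> 'm vector_field \<Rightarrow> 'm vector_field) \<Rightarrow> bool" where
  "torsion_free M D \<longleftrightarrow>
     (\<forall>X\<in>vector_fields M. \<forall>Y\<in>vector_fields M. D X Y - D Y X - lie_bracket X Y = 0)"

definition pullback_connection ::
    "('m \<Rightarrow> 'm tangent_vector set) \<Rightarrow> ('m \<Rightarrow> 'm tangent_vector \<Rightarrow> 'v) \<Rightarrow>
     ('m vector_field \<Rightarrow> ('m \<Rightarrow> 'v) \<Rightarrow> ('m \<Rightarrow> 'v)) \<Rightarrow>
     'm vector_field \<Rightarrow> 'm vector_field \<Rightarrow> 'm vector_field" where
  "pullback_connection T F D = (\<lambda>X Y p. bundle_inv T F p (D X (\<lambda>q. F q (Y q)) p))"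


section \<open>One-forms with values in the endomorphism bundle\<close>

text \<open>Smoothness of \<open>A\<close> is tested on smooth vector fields and sections, as usual for tensor fields.\<close>

definition End_one_form ::
    "('m, 'a::real_normed_vector) chart set \<Rightarrow> ('m \<Rightarrow> 'v::real_vector set) \<Rightarrow> ('m \<Rightarrow> 'v) set \<Rightarrow>
     ('m \<Rightarrow> 'm tangent_vector \<Rightarrow> 'v \<Rightarrow> 'v) \<Rightarrow> bool" where
  "End_one_form M E \<Gamma> A \<longleftrightarrow>
     (\<forall>p. \<forall>x\<in>tangent_space M p. linear_map_on (E p) (A p x) \<and> A p x ` E p \<subseteq> E p) \<and>
     (\<forall>p. \<forall>w\<in>E p. linear_map_on (tangent_space M p) (\<lambda>x. A p x w)) \<and>
     (\<forall>X\<in>vector_fields M. \<forall>s\<in>\<Gamma>. (\<lambda>p. A p (X p) (s p)) \<in> \<Gamma>)"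

text \<open>Sections of the endomorphism bundle are regarded as operators on sections. The first definition
  is \<open>A\<^sub>X\<close>, the second is \<open>D\<^sub>X B\<close> for the connection induced by \<open>D\<close> on the endomorphism bundle.\<close>

definition form_apply ::
    "('m \<Rightarrow> 'm tangent_vector \<Rightarrow> 'v \<Rightarrow> 'v) \<Rightarrow> 'm vector_field \<Rightarrow> ('m \<Rightarrow> 'v) \<Rightarrow> ('m \<Rightarrow> 'v)" where
  "form_apply A X = (\<lambda>s p. A p (X p) (s p))"

definition End_connection ::
    "('m vector_field \<Rightarrow> ('m \<Rightarrow> 'v::real_vector) \<Rightarrow> ('m \<Rightarrow> 'v)) \<Rightarrow>
     'm vector_field \<Rightarrow> (('m \<Rightarrow> 'v) \<Rightarrow> ('m \<Rightarrow> 'v)) \<Rightarrow> (('m \<Rightarrow> 'v) \<Rightarrow> ('m \<Rightarrow> 'v))" where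
  "End_connection D X B = (\<lambda>s. D X (B s) - B (D X s))"

definition ext_cov_derivative ::
    "('m vector_field \<Rightarrow> ('m \<Rightarrow> 'v::real_vector) \<Rightarrow> ('m \<Rightarrow> 'v)) \<Rightarrow>
     ('m \<Rightarrow> 'm tangent_vector \<Rightarrow> 'v \<Rightarrow> 'v) \<Rightarrow>
     'm vector_field \<Rightarrow> 'm vector_field \<Rightarrow> (('m \<Rightarrow> 'v) \<Rightarrow> ('m \<Rightarrow> 'v))" where
  "ext_cov_derivative D A X Y =
     (\<lambda>s. End_connection D X (form_apply A Y) s - End_connection D Y (form_apply A X) s
          - form_apply A (lie_bracket X Y) s)"


section \<open>Multiplications on the tangent bundle\<close>

type_synonym 'm tangent_mult = "'m \<Rightarrow> 'm tangent_vector \<Rightarrow> 'm tangent_vector \<Rightarrow> 'm tangent_vector"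

definition tangent_multiplication ::
    "('m, 'a::real_normed_vector) chart set \<Rightarrow> 'm tangent_mult \<Rightarrow> bool" where
  "tangent_multiplication M m \<longleftrightarrow>
     (\<forall>p. \<forall>x\<in>tangent_space M p. \<forall>y\<in>tangent_space M p. m p x y \<in> tangent_space M p) \<and>
     (\<forall>p. \<forall>x\<in>tangent_space M p. linear_map_on (tangent_space M p) (m p x)) \<and>
     (\<forall>p. \<forall>y\<in>tangent_space M p. linear_map_on (tangent_space M p) (\<lambda>x. m p x y)) \<and>
     (\<forall>X\<in>vector_fields M. \<forall>Y\<in>vector_fields M. (\<lambda>p. m p (X p) (Y p)) \<in> vector_fields M)"

definition commutative_mult ::
    "('m, 'a::real_normed_vector) chart set \<Rightarrow> 'm tangent_mult \<Rightarrow> bool" where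
  "commutative_mult M m \<longleftrightarrow>
     (\<forall>p. \<forall>x\<in>tangent_space M p. \<forall>y\<in>tangent_space M p. m p x y = m p y x)"

definition associative_mult ::
    "('m, 'a::real_normed_vector) chart set \<Rightarrow> 'm tangent_mult \<Rightarrow> bool" where
  "associative_mult M m \<longleftrightarrow>
     (\<forall>p. \<forall>x\<in>tangent_space M p. \<forall>y\<in>tangent_space M p. \<forall>z\<in>tangent_space M p.
        m p (m p x y) z = m p x (m p y z))"

definition unit_field ::
    "('m, 'a::real_normed_vector) chart set \<Rightarrow> 'm tangent_mult \<Rightarrow> 'm vector_field \<Rightarrow> bool" where
  "unit_field M m e \<longleftrightarrow> e \<in> vector_fields M \<and>
     (\<forall>p. \<forall>x\<in>tangent_space M p. m p (e p) x = x \<and> m p x (e p) = x)"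

definition field_mult ::
    "'m tangent_mult \<Rightarrow> 'm vector_field \<Rightarrow> 'm vector_field \<Rightarrow> 'm vector_field" where
  "field_mult m X Y = (\<lambda>p. m p (X p) (Y p))"

definition lie_derivative_mult ::
    "'m tangent_mult \<Rightarrow> 'm vector_field \<Rightarrow> 'm vector_field \<Rightarrow> 'm vector_field \<Rightarrow> 'm vector_field" where
  "lie_derivative_mult m Z X Y =
     lie_bracket Z (field_mult m X Y) - field_mult m (lie_bracket Z X) Y
     - field_mult m X (lie_bracket Z Y)"

definition F_manifold ::
    "('m::{t2_space, second_countable_topology}, 'a::{real_inner, heine_borel}) chart set \<Rightarrow>
     'm tangent_mult \<Rightarrow> 'm vector_field \<Rightarrow> bool" where
  "F_manifold M m e \<longleftrightarrow>
     smooth_manifold M \<and> tangent_multiplication M m \<and>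
     commutative_mult M m \<and> associative_mult M m \<and> unit_field M m e \<and>
     (\<forall>X\<in>vector_fields M. \<forall>Y\<in>vector_fields M. \<forall>Z\<in>vector_fields M. \<forall>W\<in>vector_fields M.
        lie_derivative_mult m (field_mult m X Y) Z W =
        field_mult m X (lie_derivative_mult m Y Z W) + field_mult m Y (lie_derivative_mult m X Z W))"

definition connection_deriv_mult ::
    "('m vector_field \<Rightarrow> 'm vector_field \<Rightarrow> 'm vector_field) \<Rightarrow> 'm tangent_mult \<Rightarrow>
     'm vector_field \<Rightarrow> 'm vector_field \<Rightarrow> 'm vector_field \<Rightarrow> 'm vector_field" where
  "connection_deriv_mult D m X Y Z =
     D X (field_mult m Y Z) - field_mult m (D X Y) Z - field_mult m Y (D X Z)"

text \<open>Total symmetry is invariance under the two adjacent transpositions, which generate all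
  permutations of the three arguments.\<close>

definition compatible_connection ::
    "('m, 'a::real_normed_vector) chart set \<Rightarrow>
     ('m vector_field \<Rightarrow> 'm vector_field \<Rightarrow> 'm vector_field) \<Rightarrow> 'm tangent_mult \<Rightarrow> bool" where
  "compatible_connection M D m \<longleftrightarrow>
     (\<forall>X\<in>vector_fields M. \<forall>Y\<in>vector_fields M. \<forall>Z\<in>vector_fields M.
        connection_deriv_mult D m X Y Z = connection_deriv_mult D m Y X Z \<and>
        connection_deriv_mult D m X Y Z = connection_deriv_mult D m X Z Y)"

end

theory Submission
  imports Defs "HOL-Real_Asymp.Real_Asymp"
begin

text \<open>Tangent vectors extend to vector fields: a section of \<open>V\<close> through a given vector is obtained from a
  local trivialization and a bump function, and \<open>F\<inverse>\<close> carries it to \<open>TM\<close>. Hence \<open>A\<^sub>x A\<^sub>y = A\<^sub>y A\<^sub>x\<close> holds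
  pointwise, and \<open>A\<^bsub>x \<circ> y\<^esub> = A\<^sub>x A\<^sub>y\<close> as \<open>F\<close> is onto, which gives part i). For \<open>\<nabla> = F\<^sup>*D\<close> one has
  \<open>F(\<nabla>\<^sub>X Y) = D\<^sub>X(A\<^sub>Y u)\<close>, so \<open>d\<^sup>D A = 0\<close> evaluated at \<open>u\<close> is the vanishing of the torsion, and
  \<open>F(\<nabla>\<^sub>X(\<circ>)(Y,Z)) = D\<^sub>X(A\<^sub>Y A\<^sub>Z u) - A\<^sub>Z D\<^sub>X(A\<^sub>Y u) - A\<^sub>Y D\<^sub>X(A\<^sub>Z u)\<close> is symmetric in \<open>X, Y\<close> by
  \<open>d\<^sup>D A = 0\<close> evaluated at \<open>A\<^sub>Z u\<close>. A torsion-free compatible connection implies the \<open>F\<close>-manifold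
  identity by pure algebra (Hertling).\<close>

section \<open>Calculus of smooth functions\<close>

text \<open>A derivative at a point of the open set \<open>S\<close> only sees values near that
  point, so equality on \<open>S\<close> passes to all directional derivatives.\<close>

lemma times_cont_differentiable_on_cong:
  assumes "open S" "\<And>x. x \<in> S \<Longrightarrow> f x = g x" "times_cont_differentiable_on k S f"
  shows "times_cont_differentiable_on k S g"
  using assms(2,3)
proof (induction k arbitrary: f g)
  case 0
  then show ?case by (simp cong: continuous_on_cong)
next
  case (Suc k)
  have D: "(g has_derivative frechet_derivative f (at x)) (at x)" if "x \<in> S" for x
  proof (rule has_derivative_transform_within_open[OF _ \<open>open S\<close> that])
    show "(f has_derivative frechet_derivative f (at x)) (at x)"
      using Suc.prems(2) that by (simp flip: frechet_derivative_works)
  qed (use Suc.prems(1) in auto)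
  have eq: "frechet_derivative f (at x) = frechet_derivative g (at x)" if "x \<in> S" for x
    using frechet_derivative_at[OF D[OF that]] .
  show ?case
    unfolding times_cont_differentiable_on.simps
  proof (intro conjI ballI allI)
    show "g differentiable at x" if "x \<in> S" for x
      using D[OF that] by (rule differentiableI)
    show "times_cont_differentiable_on k S (\<lambda>x. frechet_derivative g (at x) v)" for v
      by (rule Suc.IH[of "\<lambda>x. frechet_derivative f (at x) v"]) (use eq Suc.prems(2) in auto)
  qed
qed

lemma times_cont_differentiable_on_subset:
  "times_cont_differentiable_on k S f \<Longrightarrow> T \<subseteq> S \<Longrightarrow> times_cont_differentiable_on k T f"
  by (induction k arbitrary: f) (auto intro: continuous_on_subset)

text \<open>Continuity at a point, differentiability at a point and the derivative itself are local.
  This is what allows gluing along open sets.\<close>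

lemma times_cont_differentiable_on_open_cover:
  assumes "\<And>x. x \<in> S \<Longrightarrow> \<exists>T. open T \<and> x \<in> T \<and> times_cont_differentiable_on k T f"
  shows "times_cont_differentiable_on k S f"
  using assms
proof (induction k arbitrary: f)
  case 0
  have "isCont f x" if "x \<in> S" for x
    using 0[OF that] by (auto simp: continuous_on_eq_continuous_at)
  then show ?case
    by (simp add: continuous_at_imp_continuous_on)
next
  case (Suc k)
  show ?case
    unfolding times_cont_differentiable_on.simps
  proof (intro conjI ballI allI)
    show "f differentiable at x" if "x \<in> S" for x
      using Suc.prems[OF that] by auto
    show "times_cont_differentiable_on k S (\<lambda>x. frechet_derivative f (at x) v)" for v
      by (rule Suc.IH) (use Suc.prems in fastforce)
  qed
qed

text \<open>By uniqueness of the derivative, \<open>frechet_derivative\<close>, which is given by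
  choice, may be replaced by a derivative in closed form.\<close>

lemma times_cont_differentiable_on_SucI:
  assumes "open S"
    and "\<And>x. x \<in> S \<Longrightarrow> (f has_derivative f' x) (at x)"
    and "\<And>v. times_cont_differentiable_on k S (\<lambda>x. f' x v)"
  shows "times_cont_differentiable_on (Suc k) S f"
  unfolding times_cont_differentiable_on.simps
proof (intro conjI ballI allI)
  show "f differentiable at x" if "x \<in> S" for x
    using assms(2)[OF that] by (rule differentiableI)
  show "times_cont_differentiable_on k S (\<lambda>x. frechet_derivative f (at x) v)" for v
    by (rule times_cont_differentiable_on_cong[OF assms(1) _ assms(3)])
       (rule fun_cong[OF frechet_derivative_at[OF assms(2)]])
qed

lemma times_cont_differentiable_on_SucD:
  assumes "times_cont_differentiable_on (Suc k) S f"
  shows "x \<in> S \<Longrightarrow> (f has_derivative frechet_derivative f (at x)) (at x)"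
    and "times_cont_differentiable_on k S (\<lambda>x. frechet_derivative f (at x) v)"
  using assms by (auto simp flip: frechet_derivative_works)

text \<open>At the bottom, differentiability gives continuity. In the product and chain rules this
  lowers the order of the undifferentiated factor to that of the differentiated one.\<close>

lemma times_cont_differentiable_on_Suc_imp:
  "times_cont_differentiable_on (Suc k) S f \<Longrightarrow> times_cont_differentiable_on k S f"
proof (induction k arbitrary: f)
  case 0
  then show ?case
    by (auto intro!: continuous_at_imp_continuous_on differentiable_imp_continuous_within)
next
  case (Suc k)
  note f = times_cont_differentiable_on_SucD[OF Suc.prems]
  show ?case
    unfolding times_cont_differentiable_on.simps
  proof (intro conjI ballI allI)
    show "f differentiable at x" if "x \<in> S" for x
      using f(1)[OF that] by (rule differentiableI)
  qed (rule Suc.IH[OF f(2)])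
qed

lemma times_cont_differentiable_on_const:
  "open S \<Longrightarrow> times_cont_differentiable_on k S (\<lambda>x. c)"
proof (induction k arbitrary: c)
  case (Suc k)
  show ?case
    by (rule times_cont_differentiable_on_SucI[where f' = "\<lambda>x v. 0"]) (use Suc in auto)
qed simp

lemma times_cont_differentiable_on_add:
  assumes "open S"
  shows "times_cont_differentiable_on k S f \<Longrightarrow> times_cont_differentiable_on k S g \<Longrightarrow>
    times_cont_differentiable_on k S (\<lambda>x. f x + g x)"
proof (induction k arbitrary: f g)
  case (Suc k)
  note f = times_cont_differentiable_on_SucD[OF Suc.prems(1)]
    and g = times_cont_differentiable_on_SucD[OF Suc.prems(2)]
  show ?case
    by (rule times_cont_differentiable_on_SucI[OF assms has_derivative_add[OF f(1) g(1)]])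
       (assumption+, rule Suc.IH[OF f(2) g(2)])
qed (auto intro: continuous_on_add)

text \<open>Each term of the product rule is again \<open>b\<close> applied to two functions of
  order \<open>k\<close>, so the induction closes. A general \<open>b\<close> covers products,
  scalar multiples and inner products at once.\<close>

lemma times_cont_differentiable_on_bilinear:
  assumes "bounded_bilinear b" "open S"
  shows "times_cont_differentiable_on k S f \<Longrightarrow> times_cont_differentiable_on k S g \<Longrightarrow>
    times_cont_differentiable_on k S (\<lambda>x. b (f x) (g x))"
proof (induction k arbitrary: f g)
  case 0
  then show ?case by (simp add: bounded_bilinear.continuous_on[OF assms(1)])
next
  case (Suc k)
  note f = times_cont_differentiable_on_SucD[OF Suc.prems(1)]
    and g = times_cont_differentiable_on_SucD[OF Suc.prems(2)]
  show ?case
    by (rule times_cont_differentiable_on_SucI[OF assms(2)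
          bounded_bilinear.FDERIV[OF assms(1) f(1) g(1)]])
       (assumption+, rule times_cont_differentiable_on_add[OF assms(2)
          Suc.IH[OF Suc.prems(1)[THEN times_cont_differentiable_on_Suc_imp] g(2)]
          Suc.IH[OF f(2) Suc.prems(2)[THEN times_cont_differentiable_on_Suc_imp]]])
qed

text \<open>With the reals in between, the derivative of the composite is a product: the derivative
  of \<open>f\<close> times the ordinary derivative of \<open>g\<close> composed with
  \<open>f\<close>. The second factor falls under the induction hypothesis.\<close>

lemma times_cont_differentiable_on_compose_real:
  fixes f :: "'a::real_normed_vector \<Rightarrow> real" and g :: "real \<Rightarrow> real"
  assumes "open S"
  shows "times_cont_differentiable_on k S f \<Longrightarrow> times_cont_differentiable_on k UNIV g \<Longrightarrow>
    times_cont_differentiable_on k S (\<lambda>x. g (f x))"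
proof (induction k arbitrary: g)
  case 0
  then show ?case
    using continuous_on_compose2[of UNIV g S f] by simp
next
  case (Suc k)
  note f = times_cont_differentiable_on_SucD[OF Suc.prems(1)]
    and g = times_cont_differentiable_on_SucD[OF Suc.prems(2)]
  \<comment> \<open>A linear map on the reals is multiplication by its value at 1; this turns the
    derivative of \<open>g\<close> into a real function.\<close>
  define g' where "g' y = frechet_derivative g (at y) 1" for y
  have g': "(g has_real_derivative g' y) (at y)" for y
    unfolding g'_def has_field_derivative_def
  proof (rule has_derivative_eq_rhs[OF g(1)])
    have lin: "linear (frechet_derivative g (at y))"
      by (rule has_derivative_linear[OF g(1)]) simp
    show "frechet_derivative g (at y) = (*) (frechet_derivative g (at y) 1)"
    proof
      show "frechet_derivative g (at y) v = frechet_derivative g (at y) 1 * v" for v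
        using linear_scale[OF lin, of v 1] by (simp only: real_scaleR_def mult_1_left mult_1_right mult.commute)
    qed
  qed simp
  show ?case
  proof (rule times_cont_differentiable_on_SucI[OF assms])
    show "((\<lambda>x. g (f x)) has_derivative (\<lambda>v. frechet_derivative f (at x) v * g' (f x))) (at x)"
      if "x \<in> S" for x
      using has_derivative_compose[OF f(1)[OF that] g'[unfolded has_field_derivative_def]]
      by (simp add: mult.commute)
    have "times_cont_differentiable_on k S (\<lambda>x. g' (f x))"
      unfolding g'_def
      by (rule Suc.IH[OF Suc.prems(1)[THEN times_cont_differentiable_on_Suc_imp] g(2)])
    then show "times_cont_differentiable_on k S (\<lambda>x. frechet_derivative f (at x) v * g' (f x))" for v
      by (rule times_cont_differentiable_on_bilinear[OF bounded_bilinear_mult assms f(2)])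
  qed
qed

lemma smooth_on_cong:
  "open S \<Longrightarrow> (\<And>x. x \<in> S \<Longrightarrow> f x = g x) \<Longrightarrow> smooth_on S f \<Longrightarrow> smooth_on S g"
  unfolding smooth_on_def using times_cont_differentiable_on_cong by blast

lemma smooth_on_subset: "smooth_on S f \<Longrightarrow> T \<subseteq> S \<Longrightarrow> smooth_on T f"
  unfolding smooth_on_def using times_cont_differentiable_on_subset by blast

lemma smooth_on_Un:
  assumes "open S" "open T" "smooth_on S f" "smooth_on T f"
  shows "smooth_on (S \<union> T) f"
  unfolding smooth_on_def
proof
  show "times_cont_differentiable_on k (S \<union> T) f" for k
    by (rule times_cont_differentiable_on_open_cover) (use assms in \<open>auto simp: smooth_on_def\<close>)
qed

lemma smooth_on_const: "open S \<Longrightarrow> smooth_on S (\<lambda>x. c)"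
  by (simp add: smooth_on_def times_cont_differentiable_on_const)

lemma smooth_on_add:
  "open S \<Longrightarrow> smooth_on S f \<Longrightarrow> smooth_on S g \<Longrightarrow> smooth_on S (\<lambda>x. f x + g x)"
  by (simp add: smooth_on_def times_cont_differentiable_on_add)

lemma smooth_on_bilinear:
  "bounded_bilinear b \<Longrightarrow> open S \<Longrightarrow> smooth_on S f \<Longrightarrow> smooth_on S g \<Longrightarrow>
    smooth_on S (\<lambda>x. b (f x) (g x))"
  by (simp add: smooth_on_def times_cont_differentiable_on_bilinear)

lemma smooth_on_diff:
  assumes "open S" "smooth_on S f" "smooth_on S g"
  shows "smooth_on S (\<lambda>x. f x - g x)"
  using smooth_on_add[OF assms(1,2) smooth_on_bilinear[OF bounded_bilinear_scaleR assms(1)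
        smooth_on_const[OF assms(1), of "-1"] assms(3)]]
  by simp

lemma smooth_on_compose_real:
  fixes f :: "'a::real_normed_vector \<Rightarrow> real" and g :: "real \<Rightarrow> real"
  shows "open S \<Longrightarrow> smooth_on S f \<Longrightarrow> smooth_on UNIV g \<Longrightarrow> smooth_on S (\<lambda>x. g (f x))"
  by (simp add: smooth_on_def times_cont_differentiable_on_compose_real)

text \<open>The derivatives of \<open>x \<mapsto> exp (- 1 / x)\<close> are linear combinations of these functions.\<close>

definition flat :: "nat \<Rightarrow> real \<Rightarrow> real" where
  "flat n x = (if x > 0 then exp (- 1 / x) / x ^ n else 0)"

text \<open>From the right, exp (- 1 / x) decays faster than every power of x; from the left the
  function is constantly 0.\<close>

lemma flat_tendsto_0: "(flat n \<longlongrightarrow> 0) (at 0)"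
proof -
  have "((\<lambda>x::real. exp (- 1 / x) / x ^ n) \<longlongrightarrow> 0) (at_right 0)"
    by real_asymp
  then have "(flat n \<longlongrightarrow> 0) (at_right 0)"
    by (rule Lim_transform_eventually) (auto simp: flat_def eventually_at_filter)
  moreover have "(flat n \<longlongrightarrow> 0) (at_left 0)"
    by (rule Lim_transform_eventually[OF tendsto_const])
       (auto simp: flat_def eventually_at_filter)
  ultimately show ?thesis by (simp add: filterlim_split_at)
qed

text \<open>For x > 0 the index rises by 2 through the inner derivative 1 / x^2 and by 1 through the
  derivative of the power. For x \<le> 0 the right-hand side is 0, so one expression serves all
  x.\<close>

lemma flat_has_derivative:
  "(flat n has_real_derivative flat (n + 2) x - real n * flat (n + 1) x) (at x)"
proof (cases x "0::real" rule: linorder_cases)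
  case less
  have "((\<lambda>x. 0) has_real_derivative flat (n + 2) x - real n * flat (n + 1) x) (at x)"
    using less by (simp add: flat_def)
  then show ?thesis
    by (rule has_field_derivative_transform_within_open[of _ _ _ "{..<0}"])
       (use less in \<open>auto simp: flat_def\<close>)
next
  case equal
  \<comment> \<open>Away from 0 this difference quotient equals \<open>flat (n + 1)\<close>, whose
    limit is known.\<close>
  have "((\<lambda>t. (flat n (0 + t) - flat n 0) / t) \<longlongrightarrow> 0) (at 0)"
    by (rule Lim_transform_eventually[OF flat_tendsto_0[of "n + 1"]])
       (auto simp: flat_def eventually_at_filter)
  then show ?thesis
    using equal by (simp add: DERIV_def flat_def)
next
  case greater
  have "((\<lambda>x. exp (- 1 / x) / x ^ n) has_real_derivative flat (n + 2) x - real n * flat (n + 1) x) (at x)"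
  proof (rule DERIV_cong)
    have "((\<lambda>x. exp (- 1 / x)) has_real_derivative exp (- 1 / x) * (1 / x\<^sup>2)) (at x)"
      using greater by (auto intro!: derivative_eq_intros simp: power2_eq_square)
    then show "((\<lambda>x. exp (- 1 / x) / x ^ n) has_real_derivative
        (exp (- 1 / x) * (1 / x\<^sup>2) * x ^ n - exp (- 1 / x) * (real n * x ^ (n - Suc 0)))
          / (x ^ n * x ^ n)) (at x)"
      by (rule DERIV_divide[OF _ DERIV_pow]) (use greater in simp)
    show "(exp (- 1 / x) * (1 / x\<^sup>2) * x ^ n - exp (- 1 / x) * (real n * x ^ (n - Suc 0)))
          / (x ^ n * x ^ n) = flat (n + 2) x - real n * flat (n + 1) x"
      using greater by (cases n) (simp_all add: flat_def divide_simps power2_eq_square algebra_simps)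
  qed
  then show ?thesis
    by (rule has_field_derivative_transform_within_open[of _ _ _ "{0<..}"])
       (use greater in \<open>auto simp: flat_def\<close>)
qed

lemma smooth_on_flat: "smooth_on UNIV (flat n)"
  unfolding smooth_on_def
proof
  show "times_cont_differentiable_on k UNIV (flat n)" for k
  \<comment> \<open>\<open>n\<close> has to vary because differentiation raises the index.\<close>
  proof (induction k arbitrary: n)
    case 0
    show ?case
      by (auto intro!: continuous_at_imp_continuous_on DERIV_isCont[OF flat_has_derivative])
  next
    case (Suc k)
    note mult = times_cont_differentiable_on_bilinear[OF bounded_bilinear_mult open_UNIV]
    note const = times_cont_differentiable_on_const[OF open_UNIV]
    \<comment> \<open>The factor \<open>v\<close> is the direction of differentiation. The
      difference is written as a sum with a constant factor to fit the closure lemmas.\<close>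
    have "times_cont_differentiable_on k UNIV
        (\<lambda>x. (flat (n + 2) x + (- real n) * flat (n + 1) x) * v)" for v
      by (rule mult[OF times_cont_differentiable_on_add[OF open_UNIV Suc.IH mult[OF const Suc.IH]] const])
    then have "times_cont_differentiable_on k UNIV
        (\<lambda>x. (flat (n + 2) x - real n * flat (n + 1) x) * v)" for v
      by simp
    then show ?case
      by (rule times_cont_differentiable_on_SucI
            [OF open_UNIV flat_has_derivative[unfolded has_field_derivative_def]])
  qed
qed

section \<open>Smooth maps, bump functions and sections\<close>

lemma open_chart_image:
  assumes "smooth_manifold M" "(U, c) \<in> M" "open S"
  shows "open (c ` (U \<inter> S))"
proof -
  have "openin (top_of_set (c ` U)) (c ` (U \<inter> S))" and "open (c ` U)"
    using assms homeomorphism_imp_open_map[of U "c ` U" c "inv_into U c" "U \<inter> S"]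
    by (auto simp: smooth_manifold_def)
  then show ?thesis using openin_open_eq by blast
qed

lemma smooth_map_on_cong:
  assumes "smooth_manifold M" "open S" "\<And>q. q \<in> S \<Longrightarrow> f q = g q" "smooth_map_on M S f"
  shows "smooth_map_on M S g"
  unfolding smooth_map_on_def
proof clarify
  fix U c assume Uc: "(U, c) \<in> M"
  have inj: "inj_on c U"
    using assms(1) Uc by (metis (mono_tags, lifting) case_prodD homeomorphism_apply1 inj_on_inverseI smooth_manifold_def)
  show "smooth_on (c ` (U \<inter> S)) (g \<circ> inv_into U c)"
  proof (rule smooth_on_cong)
    show "open (c ` (U \<inter> S))" using open_chart_image[OF assms(1) Uc assms(2)] .
    show "smooth_on (c ` (U \<inter> S)) (f \<circ> inv_into U c)"
      using assms(4) Uc by (auto simp: smooth_map_on_def)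
    show "(f \<circ> inv_into U c) x = (g \<circ> inv_into U c) x" if "x \<in> c ` (U \<inter> S)" for x
      using that assms(3) inv_into_f_f[OF inj] by auto
  qed
qed

lemma smooth_map_on_subset: "smooth_map_on M S f \<Longrightarrow> T \<subseteq> S \<Longrightarrow> smooth_map_on M T f"
  unfolding smooth_map_on_def by (fast elim: smooth_on_subset)

lemma smooth_map_on_Un:
  assumes M: "smooth_manifold M" and "open S" "open T" "smooth_map_on M S f" "smooth_map_on M T f"
  shows "smooth_map_on M (S \<union> T) f"
  unfolding smooth_map_on_def
proof clarify
  fix U c assume Uc: "(U, c) \<in> M"
  have "smooth_on (c ` (U \<inter> S) \<union> c ` (U \<inter> T)) (f \<circ> inv_into U c)"
    by (rule smooth_on_Un) (use assms Uc open_chart_image[OF M Uc] in \<open>auto simp: smooth_map_on_def\<close>)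
  then show "smooth_on (c ` (U \<inter> (S \<union> T))) (f \<circ> inv_into U c)"
    by (simp add: image_Un Int_Un_distrib)
qed

lemma smooth_map_onI:
  "(\<And>U c. (U, c) \<in> M \<Longrightarrow> smooth_on (c ` (U \<inter> S)) (\<lambda>x. f (inv_into U c x))) \<Longrightarrow> smooth_map_on M S f"
  by (auto simp: smooth_map_on_def comp_def)

lemma smooth_map_onD:
  "smooth_map_on M S f \<Longrightarrow> (U, c) \<in> M \<Longrightarrow> smooth_on (c ` (U \<inter> S)) (\<lambda>x. f (inv_into U c x))"
  by (auto simp: smooth_map_on_def comp_def)

lemma smooth_map_on_const:
  assumes "smooth_manifold M" "open S"
  shows "smooth_map_on M S (\<lambda>q. a)"
  by (rule smooth_map_onI, rule smooth_on_const[OF open_chart_image[OF assms(1) _ assms(2)]])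

lemma smooth_map_on_add:
  assumes "smooth_manifold M" "open S" "smooth_map_on M S f" "smooth_map_on M S g"
  shows "smooth_map_on M S (\<lambda>q. f q + g q)"
  by (rule smooth_map_onI, rule smooth_on_add[OF open_chart_image[OF assms(1) _ assms(2)]
        assms(3,4)[THEN smooth_map_onD]])

lemma smooth_map_on_diff:
  assumes "smooth_manifold M" "open S" "smooth_map_on M S f" "smooth_map_on M S g"
  shows "smooth_map_on M S (\<lambda>q. f q - g q)"
  by (rule smooth_map_onI, rule smooth_on_diff[OF open_chart_image[OF assms(1) _ assms(2)]
        assms(3,4)[THEN smooth_map_onD]])

lemma smooth_map_on_bilinear:
  assumes "bounded_bilinear b" "smooth_manifold M" "open S" "smooth_map_on M S f" "smooth_map_on M S g"
  shows "smooth_map_on M S (\<lambda>q. b (f q) (g q))"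
  by (rule smooth_map_onI, rule smooth_on_bilinear[OF assms(1) open_chart_image[OF assms(2) _ assms(3)]
        assms(4,5)[THEN smooth_map_onD]])

lemma smooth_map_on_compose_real:
  fixes g :: "real \<Rightarrow> real"
  assumes "smooth_manifold M" "open S" "smooth_map_on M S f" "smooth_on UNIV g"
  shows "smooth_map_on M S (\<lambda>q. g (f q))"
  by (rule smooth_map_onI, rule smooth_on_compose_real[OF open_chart_image[OF assms(1) _ assms(2)]
        assms(3)[THEN smooth_map_onD] assms(4)])

text \<open>In the coordinates of another chart, a chart is a transition map of the atlas.\<close>

lemma smooth_map_on_chart:
  assumes "smooth_manifold M" "(U, c) \<in> M"
  shows "smooth_map_on M U c"
  using assms unfolding smooth_manifold_def smooth_map_on_def by fast

text \<open>The bump function is a function of the squared distance in a chart, so its smoothness needs no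
  chain rule for maps between the model spaces.\<close>

lemma bump_function:
  fixes M :: "('m::{t2_space, second_countable_topology}, 'a::{real_inner, heine_borel}) chart set"
  assumes M: "smooth_manifold M" and "open S" "p \<in> S"
  obtains \<rho> :: "'m \<Rightarrow> real" and K
  where "smooth_map_on M UNIV \<rho>" "\<rho> p \<noteq> 0" "closed K" "K \<subseteq> S" "\<And>q. q \<notin> K \<Longrightarrow> \<rho> q = 0"
proof -
  obtain U c where Uc: "(U, c) \<in> M" and "p \<in> U"
    using M unfolding smooth_manifold_def by blast
  then have "open U" and homeo: "homeomorphism U (c ` U) c (inv_into U c)"
    using M by (auto simp: smooth_manifold_def)
  note inv = homeomorphism_apply1[OF homeo]
  have "open (c ` (U \<inter> S))" by (rule open_chart_image[OF M Uc \<open>open S\<close>])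
  moreover have "c p \<in> c ` (U \<inter> S)" using \<open>p \<in> U\<close> \<open>p \<in> S\<close> by blast
  ultimately obtain r where r: "r > 0" "cball (c p) r \<subseteq> c ` (U \<inter> S)"
    using open_contains_cball by blast
  \<comment> \<open>The ball of the chart, pulled back to the manifold, will carry the bump.\<close>
  define K where "K = inv_into U c ` cball (c p) r"
  \<comment> \<open>On \<open>U\<close> the argument of \<open>flat 0\<close> is positive exactly
    inside the open ball, so the function is positive there and 0 elsewhere.\<close>
  define \<rho> where "\<rho> q = (if q \<in> U then flat 0 (r\<^sup>2 - (c q - c p) \<bullet> (c q - c p)) else 0)" for q
  have "K \<subseteq> U \<inter> S"
  proof
    fix q assume "q \<in> K"
    then obtain y where "y \<in> cball (c p) r" "q = inv_into U c y" unfolding K_def by blast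
    then obtain q' where "q' \<in> U \<inter> S" "y = c q'" using r(2) by blast
    with \<open>q = inv_into U c y\<close> inv show "q \<in> U \<inter> S" by simp
  qed
  \<comment> \<open>Closed balls are compact by the Heine-Borel property and the manifold is
    Hausdorff, so \<open>K\<close> is closed in the whole manifold and not just in \<open>U\<close>.
    Hence extension by 0 stays smooth.\<close>
  have "continuous_on (c ` U) (inv_into U c)"
    using homeo by (rule homeomorphism_cont2)
  then have "continuous_on (cball (c p) r) (inv_into U c)"
    by (rule continuous_on_subset) (use r(2) in blast)
  then have "closed K"
    unfolding K_def by (intro compact_imp_closed compact_continuous_image compact_cball)
  have vanish: "\<rho> q = 0" if "q \<notin> K" for q
  proof (cases "q \<in> U")
    case True
    have "c q \<notin> cball (c p) r"
      using that inv[OF True] unfolding K_def by (metis image_eqI)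
    then have "r < norm (c q - c p)" by (simp add: dist_norm norm_minus_commute)
    then have "r\<^sup>2 < (c q - c p) \<bullet> (c q - c p)"
      using \<open>r > 0\<close> by (simp add: power_strict_mono flip: power2_norm_eq_inner)
    then show ?thesis by (simp add: \<rho>_def flat_def)
  qed (simp add: \<rho>_def)
  have diff: "smooth_map_on M U (\<lambda>q. c q - c p)"
    by (rule smooth_map_on_diff[OF M \<open>open U\<close> smooth_map_on_chart[OF M Uc]
          smooth_map_on_const[OF M \<open>open U\<close>]])
  have "smooth_map_on M U (\<lambda>q. flat 0 (r\<^sup>2 - (c q - c p) \<bullet> (c q - c p)))"
    by (rule smooth_map_on_compose_real[OF M \<open>open U\<close>
          smooth_map_on_diff[OF M \<open>open U\<close> smooth_map_on_const[OF M \<open>open U\<close>]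
            smooth_map_on_bilinear[OF bounded_bilinear_inner M \<open>open U\<close> diff diff]]
          smooth_on_flat])
  then have "smooth_map_on M U \<rho>"
    by (rule smooth_map_on_cong[OF M \<open>open U\<close>, rotated]) (simp add: \<rho>_def)
  moreover have "smooth_map_on M (- K) \<rho>"
    by (rule smooth_map_on_cong[OF M open_Compl[OF \<open>closed K\<close>] _
          smooth_map_on_const[OF M open_Compl[OF \<open>closed K\<close>], of 0]])
       (simp add: vanish)
  \<comment> \<open>The open sets \<open>U\<close> and \<open>- K\<close> cover the manifold;
    \<open>\<rho>\<close> is given by the formula on the first and is 0 on the second.\<close>
  ultimately have "smooth_map_on M (U \<union> - K) \<rho>"
    using \<open>open U\<close> \<open>closed K\<close> by (intro smooth_map_on_Un[OF M]) auto
  moreover have "U \<union> - K = UNIV" using \<open>K \<subseteq> U \<inter> S\<close> by blast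
  moreover have "\<rho> p \<noteq> 0" using \<open>p \<in> U\<close> \<open>r > 0\<close> by (simp add: \<rho>_def flat_def)
  ultimately show ?thesis
    using that[of \<rho> K] \<open>closed K\<close> \<open>K \<subseteq> U \<inter> S\<close> vanish by auto
qed

lemma linear_map_on_add: "linear_map_on S f \<Longrightarrow> x \<in> S \<Longrightarrow> y \<in> S \<Longrightarrow> f (x + y) = f x + f y"
  by (simp add: linear_map_on_def)

lemma linear_map_on_scaleR: "linear_map_on S f \<Longrightarrow> x \<in> S \<Longrightarrow> f (a *\<^sub>R x) = a *\<^sub>R f x"
  by (simp add: linear_map_on_def)

lemma linear_map_on_zero: "linear_map_on S f \<Longrightarrow> 0 \<in> S \<Longrightarrow> f 0 = 0"
  using linear_map_on_scaleR[of S f 0 0] by simp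

lemma linear_map_on_diff:
  assumes "linear_map_on S f" "subspace S" "x \<in> S" "y \<in> S"
  shows "f (x - y) = f x - f y"
  using linear_map_on_add[OF assms(1) subspace_diff[OF assms(2-4)] assms(4)] by simp

text \<open>A section that is constant in a trivialization around \<open>p\<close> is multiplied by
  a bump function and extended by 0.\<close>

lemma smooth_section_through:
  fixes M :: "('m::{t2_space, second_countable_topology}, 'a::{real_inner, heine_borel}) chart set"
  assumes M: "smooth_manifold M" and B: "vector_bundle M V \<Phi>" and "v \<in> V p"
  obtains s where "s \<in> smooth_sections M V \<Phi>" "s p = v"
proof -
  note B' = B[unfolded vector_bundle_def]
  have sub: "subspace (V q)" for q using conjunct1[OF B'] by blast
  have triv: "open W \<and> (\<forall>q\<in>W. linear_map_on (V q) (\<psi> q) \<and> bij_betw (\<psi> q) (V q) UNIV)"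
    if "(W, \<psi>) \<in> \<Phi>" for W \<psi>
    using bspec[OF conjunct1[OF conjunct2[OF B']] that] by simp
  have trans: "smooth_map_on M (U \<inter> W) (\<lambda>q. \<psi> q (inv_into (V q) (\<phi> q) w))"
    if "(U, \<phi>) \<in> \<Phi>" "(W, \<psi>) \<in> \<Phi>" for U \<phi> W \<psi> w
  proof -
    have "\<forall>(W, \<psi>)\<in>\<Phi>. \<forall>w. smooth_map_on M (U \<inter> W) (\<lambda>q. \<psi> q (inv_into (V q) (\<phi> q) w))"
      using bspec[OF conjunct2[OF conjunct2[OF conjunct2[OF B']]] that(1)] by simp
    from bspec[OF this that(2)] show ?thesis by simp
  qed
  have "p \<in> (\<Union>(U, \<phi>)\<in>\<Phi>. U)"
    using conjunct1[OF conjunct2[OF conjunct2[OF B']]] by simp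
  then obtain U \<phi> where U: "(U, \<phi>) \<in> \<Phi>" "p \<in> U" by auto
  have "open U" using triv[OF U(1)] by blast
  obtain \<rho> :: "'m \<Rightarrow> real" and K where \<rho>: "smooth_map_on M UNIV \<rho>" "\<rho> p \<noteq> 0" "closed K" "K \<subseteq> U"
      "\<And>q. q \<notin> K \<Longrightarrow> \<rho> q = 0"
    using bump_function[OF M \<open>open U\<close> U(2)] by blast
  \<comment> \<open>The coordinates of \<open>v\<close> at \<open>p\<close> are kept constant. In
    any other trivialization this section is a transition function on a fixed vector, hence smooth
    by \<open>vector_bundle\<close>.\<close>
  define e where "e q = inv_into (V q) (\<phi> q) (\<phi> p v)" for q
  \<comment> \<open>Division by \<open>\<rho> p\<close> makes the value at \<open>p\<close> exactly
    \<open>v\<close>.\<close>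
  define s where "s q = (if q \<in> U then (\<rho> q / \<rho> p) *\<^sub>R e q else 0)" for q
  have e_mem: "e q \<in> V q" if "q \<in> U" for q
  proof -
    have "\<phi> q ` V q = UNIV" using triv[OF U(1)] that by (simp add: bij_betw_def)
    then show ?thesis unfolding e_def by (intro inv_into_into) simp
  qed
  have "inj_on (\<phi> p) (V p)" using triv[OF U(1)] U(2) by (simp add: bij_betw_def)
  then have "e p = v" unfolding e_def using \<open>v \<in> V p\<close> by (rule inv_into_f_f)
  then have "s p = v" using U(2) \<rho>(2) by (simp add: s_def)
  have mem: "s q \<in> V q" for q
    using e_mem sub by (auto simp: s_def subspace_scale subspace_0)
  have "smooth_map_on M W (\<lambda>q. \<psi> q (s q))" if W: "(W, \<psi>) \<in> \<Phi>" for W \<psi>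
  proof -
    have "open W" and lin: "\<And>q. q \<in> W \<Longrightarrow> linear_map_on (V q) (\<psi> q)"
      using triv[OF W] by auto
    \<comment> \<open>These sets cover \<open>W\<close>: on the first, \<open>s\<close> is a smooth
      multiple of \<open>e\<close>; on the second it vanishes.\<close>
    have o1: "open (U \<inter> W)" and o2: "open (W \<inter> - K)"
      using \<open>open U\<close> \<open>open W\<close> \<rho>(3) by auto
    have "smooth_map_on M (U \<inter> W) (\<lambda>q. (1 / \<rho> p * \<rho> q) *\<^sub>R \<psi> q (e q))"
      unfolding e_def
      by (rule smooth_map_on_bilinear[OF bounded_bilinear_scaleR M o1
            smooth_map_on_bilinear[OF bounded_bilinear_mult M o1 smooth_map_on_const[OF M o1]
              smooth_map_on_subset[OF \<rho>(1) subset_UNIV]] trans[OF U(1) W]])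
    then have 1: "smooth_map_on M (U \<inter> W) (\<lambda>q. \<psi> q (s q))"
      by (rule smooth_map_on_cong[OF M o1, rotated])
         (auto simp: s_def linear_map_on_scaleR[OF lin e_mem])
    have 2: "smooth_map_on M (W \<inter> - K) (\<lambda>q. \<psi> q (s q))"
      by (rule smooth_map_on_cong[OF M o2 _ smooth_map_on_const[OF M o2, of 0]])
         (auto simp: s_def \<rho>(5) linear_map_on_zero[OF lin subspace_0[OF sub]])
    have "(U \<inter> W) \<union> (W \<inter> - K) = W" using \<rho>(4) by blast
    with smooth_map_on_Un[OF M o1 o2 1 2] show ?thesis by simp
  qed
  then have "s \<in> smooth_sections M V \<Phi>"
    using mem unfolding smooth_sections_def by auto
  with \<open>s p = v\<close> that show ?thesis by blast
qed

section \<open>Vector fields\<close>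

context
  fixes M :: "('m::{t2_space, second_countable_topology}, 'a::{real_inner, heine_borel}) chart set"
  assumes M: "smooth_manifold M"
begin

lemma smooth_functions_const: "(\<lambda>q. a) \<in> smooth_functions M"
  by (simp add: smooth_functions_def smooth_map_on_const[OF M])

lemma smooth_functions_add:
  "f \<in> smooth_functions M \<Longrightarrow> g \<in> smooth_functions M \<Longrightarrow> (\<lambda>q. f q + g q) \<in> smooth_functions M"
  by (simp add: smooth_functions_def smooth_map_on_add[OF M])

lemma smooth_functions_diff:
  "f \<in> smooth_functions M \<Longrightarrow> g \<in> smooth_functions M \<Longrightarrow> (\<lambda>q. f q - g q) \<in> smooth_functions M"
  by (simp add: smooth_functions_def smooth_map_on_diff[OF M])

lemma smooth_functions_mult:
  "f \<in> smooth_functions M \<Longrightarrow> g \<in> smooth_functions M \<Longrightarrow> (\<lambda>q. f q * g q) \<in> smooth_functions M"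
  by (simp add: smooth_functions_def smooth_map_on_bilinear[OF bounded_bilinear_mult M])

lemma subspace_tangent_space: "subspace (tangent_space M p)"
  unfolding subspace_def tangent_space_def
  by (auto simp: scaleR_fun_def algebra_simps)

lemma vector_fields_tangent: "X \<in> vector_fields M \<Longrightarrow> X p \<in> tangent_space M p"
  by (simp add: vector_fields_def)

lemma vector_fields_smooth:
  "X \<in> vector_fields M \<Longrightarrow> f \<in> smooth_functions M \<Longrightarrow> (\<lambda>p. X p f) \<in> smooth_functions M"
  by (simp add: vector_fields_def)

lemma vector_fields_add: "X \<in> vector_fields M \<Longrightarrow> Y \<in> vector_fields M \<Longrightarrow> X + Y \<in> vector_fields M"
  using subspace_add[OF subspace_tangent_space] smooth_functions_add
  by (simp add: vector_fields_def)

lemma vector_fields_diff: "X \<in> vector_fields M \<Longrightarrow> Y \<in> vector_fields M \<Longrightarrow> X - Y \<in> vector_fields M"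
  using subspace_diff[OF subspace_tangent_space] smooth_functions_diff
  by (simp add: vector_fields_def)

text \<open>When the commutator is applied to a product of functions, the mixed terms cancel, which
  leaves a derivation.\<close>

lemma lie_bracket_vector_fields:
  assumes X: "X \<in> vector_fields M" and Y: "Y \<in> vector_fields M"
  shows "lie_bracket X Y \<in> vector_fields M"
proof -
  have T: "v (\<lambda>q. f q + g q) = v f + v g" "v (\<lambda>q. a * f q) = a * v f"
      "v (\<lambda>q. f q * g q) = v f * g p + f p * v g"
    if "v \<in> tangent_space M p" "f \<in> smooth_functions M" "g \<in> smooth_functions M" for v p f g a
    using that unfolding tangent_space_def by auto
  have N: "v f = 0" if "v \<in> tangent_space M p" "f \<notin> smooth_functions M" for v p f
    using that unfolding tangent_space_def by auto
  \<comment> \<open>On a function that is not smooth the inner field takes the default value 0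
    everywhere, so the outer field is applied to the zero function.\<close>
  have Z: "v (\<lambda>q. 0) = 0" if "v \<in> tangent_space M p" for v p
    using T(2)[OF that smooth_functions_const smooth_functions_const, where a = 0] by simp
  note tan = vector_fields_tangent[OF X] vector_fields_tangent[OF Y]
  note sm = vector_fields_smooth[OF X] vector_fields_smooth[OF Y]
  have "lie_bracket X Y p \<in> tangent_space M p" for p
    unfolding tangent_space_def lie_bracket_def
    by (auto simp: T[OF tan(1)] T[OF tan(2)] N[OF tan(1)] N[OF tan(2)] Z[OF tan(1)] Z[OF tan(2)] sm
        smooth_functions_add smooth_functions_mult algebra_simps)
  moreover have "(\<lambda>p. lie_bracket X Y p f) \<in> smooth_functions M" if "f \<in> smooth_functions M" for f
    unfolding lie_bracket_def
    by (rule smooth_functions_diff[OF sm(1)[OF sm(2)[OF that]] sm(2)[OF sm(1)[OF that]]])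
  ultimately show ?thesis by (simp add: vector_fields_def)
qed

end

section \<open>Torsion-free compatible connections\<close>

text \<open>\<open>G\<close> stands for the vector fields, \<open>m\<close> for the product,
  \<open>N\<close> for the connection and \<open>B\<close> for the bracket. Vanishing torsion
  expresses \<open>L\<close> through \<open>C\<close> and \<open>N\<close>; the terms with
  \<open>N\<close> cancel, and the identity \<open>key\<close> in \<open>C\<close> alone
  remains.\<close>

lemma hertling_identity:
  fixes G :: "'g::ab_group_add set" and m :: "'g \<Rightarrow> 'g \<Rightarrow> 'g" and N B :: "'g \<Rightarrow> 'g \<Rightarrow> 'g"
  defines "C \<equiv> \<lambda>x y z. N x (m y z) - m (N x y) z - m y (N x z)"
    and "L \<equiv> \<lambda>z x y. B z (m x y) - m (B z x) y - m x (B z y)"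
  assumes add: "\<And>x y. x \<in> G \<Longrightarrow> y \<in> G \<Longrightarrow> x + y \<in> G"
    and diff: "\<And>x y. x \<in> G \<Longrightarrow> y \<in> G \<Longrightarrow> x - y \<in> G"
    and mult: "\<And>x y. x \<in> G \<Longrightarrow> y \<in> G \<Longrightarrow> m x y \<in> G"
    and N: "\<And>x y. x \<in> G \<Longrightarrow> y \<in> G \<Longrightarrow> N x y \<in> G"
    and m_add: "\<And>x y z. x \<in> G \<Longrightarrow> y \<in> G \<Longrightarrow> z \<in> G \<Longrightarrow> m x (y + z) = m x y + m x z"
    and m_comm: "\<And>x y. x \<in> G \<Longrightarrow> y \<in> G \<Longrightarrow> m x y = m y x"
    and m_assoc: "\<And>x y z. x \<in> G \<Longrightarrow> y \<in> G \<Longrightarrow> z \<in> G \<Longrightarrow> m (m x y) z = m x (m y z)"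
    and torsion: "\<And>x y. x \<in> G \<Longrightarrow> y \<in> G \<Longrightarrow> B x y = N x y - N y x"
    and C_sym: "\<And>x y z. x \<in> G \<Longrightarrow> y \<in> G \<Longrightarrow> z \<in> G \<Longrightarrow> C x y z = C y x z"
      "\<And>x y z. x \<in> G \<Longrightarrow> y \<in> G \<Longrightarrow> z \<in> G \<Longrightarrow> C x y z = C x z y"
    and G: "x \<in> G" "y \<in> G" "z \<in> G" "w \<in> G"
  shows "L (m x y) z w = m x (L y z w) + m y (L x z w)"
proof -
  note cl = add diff mult N
  have m_diff: "m a (b - c) = m a b - m a c" if "a \<in> G" "b \<in> G" "c \<in> G" for a b c
    using m_add[OF that(1) diff[OF that(2,3)] that(3)] by simp
  have m_left: "m b (m a c) = m a (m b c)" if "a \<in> G" "b \<in> G" "c \<in> G" for a b c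
    using that by (simp flip: m_assoc add: m_comm[of b a])
  have C_mem: "C a b c \<in> G" if "a \<in> G" "b \<in> G" "c \<in> G" for a b c
    unfolding C_def using that by (simp add: cl)
  have L_eq: "L p a b = C p a b - N (m a b) p + m b (N a p) + m a (N b p)"
    if "p \<in> G" "a \<in> G" "b \<in> G" for p a b
  proof -
    have "m (N p a - N a p) b = m b (N p a) - m b (N a p)"
      using that by (simp add: m_comm[of _ b] m_diff cl)
    then show ?thesis
      unfolding L_def C_def using that
      by (simp add: torsion cl m_diff m_comm[of "N p a" b])
  qed
  have N_mult: "N a (m b c) = C a b c + m c (N a b) + m b (N a c)"
    if "a \<in> G" "b \<in> G" "c \<in> G" for a b c
    unfolding C_def using that by (simp add: m_comm[of "N a b" c] cl)
  text \<open>The sum is symmetric in \<open>b\<close>, \<open>c\<close>, \<open>d\<close>: it is the defect of the Leibniz rule for a triple product.\<close>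
  have triple: "C a (m b c) d + m d (C a b c) = C a (m c d) b + m b (C a c d)"
    if "a \<in> G" "b \<in> G" "c \<in> G" "d \<in> G" for a b c d
  proof -
    \<comment> \<open>Quantified afresh because it is used twice, the second time with
      \<open>b\<close>, \<open>c\<close>, \<open>d\<close> permuted cyclically.\<close>
    have *: "C a (m b c) d + m d (C a b c) =
        N a (m b (m c d)) - m b (m c (N a d)) - m b (m d (N a c)) - m c (m d (N a b))"
      if "a \<in> G" "b \<in> G" "c \<in> G" "d \<in> G" for a b c d
    proof -
      have "m d (C a b c) = m d (N a (m b c)) - m c (m d (N a b)) - m b (m d (N a c))"
        unfolding C_def using that
        by (simp add: m_diff cl m_comm[of "N a b" c] m_left[of c d] m_left[of b d])
      moreover have "C a (m b c) d = N a (m b (m c d)) - m d (N a (m b c)) - m b (m c (N a d))"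
        unfolding C_def using that by (simp add: m_assoc cl m_comm[of "N a (m b c)" d])
      ultimately show ?thesis by simp
    qed
    have "m b (m c d) = m c (m d b)"
      using that by (simp add: m_left[of c b] m_comm[of d b])
    moreover have "m c (m d (N a b)) = m d (m c (N a b))" "m b (m c (N a d)) = m c (m b (N a d))"
        "m b (m d (N a c)) = m d (m b (N a c))"
      using that by (simp_all add: m_left cl)
    ultimately show ?thesis
      unfolding *[OF that] *[OF that(1,3,4,2)] by simp
  qed
  \<comment> \<open>Two instances of \<open>triple\<close> are brought to the common term
    \<open>C z (m y w) x\<close> by the symmetry of \<open>C\<close>; their difference is the
    claim.\<close>
  have key: "C (m x y) z w - C (m z w) x y + m w (C z x y) + m z (C w x y) =
      m x (C y z w) + m y (C x z w)"
  proof -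
    have "C (m x y) z w + m w (C z x y) = C z (m y w) x + m x (C y z w)"
      using triple[of z x y w] C_sym(1)[of "m x y" z w] C_sym(1)[of y z w] G by (simp add: mult)
    moreover have "C (m z w) x y + m y (C x z w) = C z (m y w) x + m z (C w x y)"
      using triple[of x z w y] C_sym(1)[of "m z w" x y] C_sym(1)[of w x y]
        C_sym(1)[of x z "m y w"] C_sym(2)[of z x "m y w"] C_sym(2)[of x "m y w" z]
        m_comm[of w y] G by (simp add: mult)
    ultimately show ?thesis by (simp add: algebra_simps)
  qed
  \<comment> \<open>These expand \<open>N\<close> of a product by its Leibniz rule with defect
    \<open>C\<close>, so that the terms with \<open>N\<close> match on both sides of the
    goal.\<close>
  have 1: "m w (N z (m x y)) = m w (C z x y) + m w (m y (N z x)) + m w (m x (N z y))"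
    and 2: "m z (N w (m x y)) = m z (C w x y) + m z (m y (N w x)) + m z (m x (N w y))"
    and 3: "N (m z w) (m x y) = C (m z w) x y + m y (N (m z w) x) + m x (N (m z w) y)"
    using G by (simp_all add: N_mult m_add cl C_mem)
  have 4: "m a (L b z w) = m a (C b z w) - m a (N (m z w) b) + m w (m a (N z b)) + m z (m a (N w b))"
    if "a \<in> G" "b \<in> G" for a b
    using that G by (simp add: L_eq m_add m_diff cl C_mem m_left[of w a] m_left[of z a])
  show ?thesis
    unfolding L_eq[OF mult[OF G(1,2)] G(3,4)] 1 2 3 4[OF G(1,2)] 4[OF G(2,1)]
    using key by (simp add: algebra_simps)
qed

text \<open>The fibrewise laws of \<open>m\<close> are lifted to vector fields, where
  \<open>hertling_identity\<close> applies.\<close>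

lemma F_manifold_if_compatible_connection:
  assumes M: "smooth_manifold M"
    and m: "tangent_multiplication M m" "commutative_mult M m" "associative_mult M m"
    and unit: "unit_field M m e"
    and N: "connection M (vector_fields M) N" "torsion_free M N" "compatible_connection M N m"
  shows "F_manifold M m e"
proof -
  have T: "X p \<in> tangent_space M p" if "X \<in> vector_fields M" for X p
    by (rule vector_fields_tangent[OF M that])
  have mult: "field_mult m X Y \<in> vector_fields M"
    if "X \<in> vector_fields M" "Y \<in> vector_fields M" for X Y
    using m(1) that by (simp add: tangent_multiplication_def field_mult_def)
  have m_add: "field_mult m X (Y + Z) = field_mult m X Y + field_mult m X Z"
    if "X \<in> vector_fields M" "Y \<in> vector_fields M" "Z \<in> vector_fields M" for X Y Z
  proof
    fix p
    have "linear_map_on (tangent_space M p) (m p (X p))"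
      using m(1) T[OF that(1)] by (simp add: tangent_multiplication_def)
    from linear_map_on_add[OF this T[OF that(2)] T[OF that(3)]]
    show "field_mult m X (Y + Z) p = (field_mult m X Y + field_mult m X Z) p"
      by (simp add: field_mult_def)
  qed
  have comm: "field_mult m X Y = field_mult m Y X"
    if "X \<in> vector_fields M" "Y \<in> vector_fields M" for X Y
    using m(2) T that by (simp add: commutative_mult_def field_mult_def fun_eq_iff)
  have assoc: "field_mult m (field_mult m X Y) Z = field_mult m X (field_mult m Y Z)"
    if "X \<in> vector_fields M" "Y \<in> vector_fields M" "Z \<in> vector_fields M" for X Y Z
    using m(3) T that by (simp add: associative_mult_def field_mult_def)
  have cl: "N X Y \<in> vector_fields M" if "X \<in> vector_fields M" "Y \<in> vector_fields M" for X Y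
    using N(1) that by (simp add: connection_def)
  have tors: "lie_bracket X Y = N X Y - N Y X"
    if "X \<in> vector_fields M" "Y \<in> vector_fields M" for X Y
    using N(2) that by (simp add: torsion_free_def)
  have sym: "connection_deriv_mult N m X Y Z = connection_deriv_mult N m Y X Z"
      "connection_deriv_mult N m X Y Z = connection_deriv_mult N m X Z Y"
    if "X \<in> vector_fields M" "Y \<in> vector_fields M" "Z \<in> vector_fields M" for X Y Z
    using N(3) that by (simp_all add: compatible_connection_def)
  have "lie_derivative_mult m (field_mult m X Y) Z W =
      field_mult m X (lie_derivative_mult m Y Z W) + field_mult m Y (lie_derivative_mult m X Z W)"
    if "X \<in> vector_fields M" "Y \<in> vector_fields M" "Z \<in> vector_fields M" "W \<in> vector_fields M"
    for X Y Z W
    unfolding lie_derivative_mult_def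
    by (rule hertling_identity[where G = "vector_fields M" and m = "field_mult m" and N = N
          and B = lie_bracket, OF vector_fields_add[OF M] vector_fields_diff[OF M] mult cl m_add comm
          assoc tors sym[unfolded connection_deriv_mult_def] that])
  with M m unit show ?thesis by (simp add: F_manifold_def)
qed

section \<open>The multiplication defined by a flat one-form\<close>

theorem proposition30:
  fixes M :: "('m::{t2_space, second_countable_topology}, 'a::{real_inner, heine_borel}) chart set"
    and V :: "'m \<Rightarrow> 'v::real_vector set"
    and \<Phi> :: "('m, 'v, 'k::{real_inner, heine_borel}) trivialization set"
    and D :: "'m vector_field \<Rightarrow> ('m \<Rightarrow> 'v) \<Rightarrow> ('m \<Rightarrow> 'v)"
    and A :: "'m \<Rightarrow> 'm tangent_vector \<Rightarrow> 'v \<Rightarrow> 'v"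
    and u :: "'m \<Rightarrow> 'v"
    and F :: "'m \<Rightarrow> 'm tangent_vector \<Rightarrow> 'v"
    and mult :: "'m tangent_mult"
    and e :: "'m vector_field"
  assumes "smooth_manifold M"
    and "vector_bundle M V \<Phi>"
    and "connection M (smooth_sections M V \<Phi>) D"
    and "End_one_form M V (smooth_sections M V \<Phi>) A"
    and "\<forall>X\<in>vector_fields M. \<forall>Y\<in>vector_fields M. \<forall>s\<in>smooth_sections M V \<Phi>.
           ext_cov_derivative D A X Y s = 0"
    and "\<forall>X\<in>vector_fields M. \<forall>Y\<in>vector_fields M. \<forall>s\<in>smooth_sections M V \<Phi>.
           form_apply A X (form_apply A Y s) = form_apply A Y (form_apply A X s)"
    and "u \<in> smooth_sections M V \<Phi>"
    and "\<forall>Y\<in>vector_fields M. \<forall>Z\<in>vector_fields M.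
           form_apply A Y (D Z u) = form_apply A Z (D Y u)"
    and F_def: "F = (\<lambda>p x. A p x (u p))"
    and "bundle_iso (tangent_space M) (vector_fields M) V (smooth_sections M V \<Phi>) F"
    and mult_def: "mult = (\<lambda>p x y. bundle_inv (tangent_space M) F p (A p x (A p y (u p))))"
    and e_def: "e = (\<lambda>p. bundle_inv (tangent_space M) F p (u p))"
  shows "(tangent_multiplication M mult \<and> commutative_mult M mult \<and> associative_mult M mult \<and>
            unit_field M mult e) \<and>
         (connection M (vector_fields M) (pullback_connection (tangent_space M) F D) \<and>
            torsion_free M (pullback_connection (tangent_space M) F D) \<and>
            compatible_connection M (pullback_connection (tangent_space M) F D) mult) \<and>
         F_manifold M mult e"
proof -
  let ?T = "tangent_space M" and ?X = "vector_fields M" and ?\<Gamma> = "smooth_sections M V \<Phi>"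
  let ?G = "bundle_inv ?T F" and ?N = "pullback_connection ?T F D"
  note M = assms(1) and VB = assms(2) and conn = assms(3) and form = assms(4) and u = assms(7)
    and iso = assms(10)
  have T: "X p \<in> ?T p" if "X \<in> ?X" for X p by (rule vector_fields_tangent[OF M that])
  have S: "s p \<in> V p" if "s \<in> ?\<Gamma>" for s p using that by (simp add: smooth_sections_def)
  note subT = subspace_tangent_space[OF M]
  have subV: "subspace (V p)" for p using conjunct1[OF VB[unfolded vector_bundle_def]] by blast

  \<comment> \<open>Fibrewise properties of the one-form and of the isomorphism\<close>
  have A_lin: "linear_map_on (V p) (A p x)" if "x \<in> ?T p" for p x
    using form that by (simp add: End_one_form_def)
  have A_mem: "A p x v \<in> V p" if "x \<in> ?T p" "v \<in> V p" for p x v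
    using form that unfolding End_one_form_def by blast
  have A_lin2: "linear_map_on (?T p) (\<lambda>x. A p x v)" if "v \<in> V p" for p v
    using form that by (simp add: End_one_form_def)
  have A_sec: "form_apply A X s \<in> ?\<Gamma>" if "X \<in> ?X" "s \<in> ?\<Gamma>" for X s
    using form that by (simp add: End_one_form_def form_apply_def)

  have F: "linear_map_on (?T p) (F p)" "F p ` ?T p \<subseteq> V p" "bij_betw (F p) (?T p) (V p)" for p
    using iso by (auto simp: bundle_iso_def bundle_hom_def)
  have G_lin: "linear_map_on (V p) (?G p)" for p
    using iso by (simp add: bundle_iso_def bundle_hom_def)
  have G_mem: "?G p v \<in> ?T p" if "v \<in> V p" for p v
    using iso that unfolding bundle_iso_def bundle_hom_def by blast
  have F_sec: "(\<lambda>p. F p (X p)) \<in> ?\<Gamma>" if "X \<in> ?X" for X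
    using iso that by (simp add: bundle_iso_def bundle_hom_def)
  have G_sec: "(\<lambda>p. ?G p (s p)) \<in> ?X" if "s \<in> ?\<Gamma>" for s
    using iso that by (simp add: bundle_iso_def bundle_hom_def)
  have FG: "F p (?G p v) = v" if "v \<in> V p" for p v
    using F(3)[of p] that by (simp add: bundle_inv_def bij_betw_def f_inv_into_f)
  have GF: "?G p (F p x) = x" if "x \<in> ?T p" for p x
    using F(3)[of p] that by (simp add: bundle_inv_def bij_betw_def)
  have F_inj: "x = y" if "F p x = F p y" "x \<in> ?T p" "y \<in> ?T p" for p x y
    using GF[OF that(2), unfolded that(1) GF[OF that(3)]] by (rule sym)
  have F_apply: "F p x = A p x (u p)" for p x by (simp add: F_def)
  have up: "u p \<in> V p" for p by (rule S[OF u])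

  \<comment> \<open>Commutation of the endomorphisms at a point\<close>
  have A_comm: "A p x (A p y v) = A p y (A p x v)"
    if xyv: "x \<in> ?T p" "y \<in> ?T p" "v \<in> V p" for p x y v
  proof -
    \<comment> \<open>The extension is made in \<open>V\<close>, where trivializations are at hand,
      and carried to the tangent bundle by the inverse of \<open>F\<close>.\<close>
    have ext: "\<exists>X\<in>?X. X p = x" if x: "x \<in> ?T p" for x
    proof -
      have "F p x \<in> V p" using F(2) x by blast
      then obtain s where s: "s \<in> ?\<Gamma>" "s p = F p x"
        using smooth_section_through[OF M VB] by blast
      show ?thesis by (rule bexI[OF _ G_sec[OF s(1)]]) (simp add: s(2) GF[OF x])
    qed
    obtain X Y where XY: "X \<in> ?X" "X p = x" "Y \<in> ?X" "Y p = y"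
      using ext[OF xyv(1)] ext[OF xyv(2)] by blast
    obtain s where s: "s \<in> ?\<Gamma>" "s p = v"
      using smooth_section_through[OF M VB xyv(3)] by blast
    have "form_apply A X (form_apply A Y s) = form_apply A Y (form_apply A X s)"
      using assms(6) XY s by blast
    from fun_cong[OF this, of p] show ?thesis by (simp add: form_apply_def XY s)
  qed

  \<comment> \<open>The multiplication and its unit\<close>
  have m_eq: "mult p x y = ?G p (A p x (A p y (u p)))" for p x y by (simp add: mult_def)
  have m_mem: "mult p x y \<in> ?T p" if "x \<in> ?T p" "y \<in> ?T p" for p x y
    unfolding m_eq by (rule G_mem[OF A_mem[OF that(1) A_mem[OF that(2) up]]])
  have A_m_u: "A p (mult p x y) (u p) = A p x (A p y (u p))" if "x \<in> ?T p" "y \<in> ?T p" for p x y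
    using FG[OF A_mem[OF that(1) A_mem[OF that(2) up]]] by (simp add: F_apply m_eq)
  have comm: "mult p x y = mult p y x" if "x \<in> ?T p" "y \<in> ?T p" for p x y
    unfolding m_eq by (simp only: A_comm[OF that up])
  have assoc: "mult p (mult p x y) z = mult p x (mult p y z)"
    if xyz: "x \<in> ?T p" "y \<in> ?T p" "z \<in> ?T p" for p x y z
  proof -
    \<comment> \<open>The product law \<open>A_m_u\<close> holds at \<open>u\<close>, so
      \<open>A p z\<close> is first moved to the left until \<open>A p (mult p x y)\<close> meets
      \<open>u\<close>; then it is moved back.\<close>
    have "A p (mult p x y) (A p z (u p)) = A p z (A p x (A p y (u p)))"
      by (simp only: A_comm[OF m_mem[OF xyz(1,2)] xyz(3) up] A_m_u[OF xyz(1,2)])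
    also have "\<dots> = A p x (A p (mult p y z) (u p))"
      by (simp only: A_comm[OF xyz(3,1) A_mem[OF xyz(2) up]] A_comm[OF xyz(3,2) up] A_m_u[OF xyz(2,3)])
    finally show ?thesis
      unfolding m_eq[of p "mult p x y" z] m_eq[of p x "mult p y z"] by (rule arg_cong)
  qed
  have m_lin: "linear_map_on (?T p) (mult p x)" if x: "x \<in> ?T p" for p x
    unfolding linear_map_on_def m_eq
    using A_lin2[OF up] A_lin[OF x] G_lin x A_mem up
    by (auto simp: linear_map_on_def)
  have m_lin2: "linear_map_on (?T p) (\<lambda>x. mult p x y)" if y: "y \<in> ?T p" for p y
    using m_lin[OF y] comm[OF y] subspace_add[OF subT] subspace_scale[OF subT]
    by (auto simp: linear_map_on_def)
  have m_field: "(\<lambda>p. mult p (X p) (Y p)) \<in> ?X" if "X \<in> ?X" "Y \<in> ?X" for X Y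
    using G_sec[OF A_sec[OF that(1) A_sec[OF that(2) u]]] by (simp add: m_eq form_apply_def)
  have tm: "tangent_multiplication M mult"
    using m_mem m_lin m_lin2 m_field by (simp add: tangent_multiplication_def)
  have cm: "commutative_mult M mult" using comm by (simp add: commutative_mult_def)
  have am: "associative_mult M mult" using assoc by (simp add: associative_mult_def)
  have um: "unit_field M mult e"
  proof -
    have "e \<in> ?X" using G_sec[OF u] by (simp add: e_def)
    \<comment> \<open>Since \<open>F\<close> sends \<open>e\<close> to \<open>u\<close>, the
      endomorphism of \<open>e\<close> fixes \<open>u\<close>, and what remains is the inverse of
      \<open>F\<close> applied to \<open>F p x\<close>.\<close>
    moreover have "mult p x (e p) = x" if x: "x \<in> ?T p" for p x
      using FG[OF up[of p]] GF[OF x] by (simp add: m_eq e_def F_apply)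
    ultimately show ?thesis
      using comm[OF T] by (simp add: unit_field_def)
  qed

  \<comment> \<open>The pull-back connection\<close>
  have D_sec: "D X s \<in> ?\<Gamma>" if "X \<in> ?X" "s \<in> ?\<Gamma>" for X s
    using conn that by (simp add: connection_def)
  have N_eq: "?N X Y = (\<lambda>p. ?G p (D X (form_apply A Y u) p))" for X Y
    by (simp add: pullback_connection_def form_apply_def F_apply)
  have N_mem: "?N X Y \<in> ?X" if "X \<in> ?X" "Y \<in> ?X" for X Y
    unfolding N_eq by (rule G_sec[OF D_sec[OF that(1) A_sec[OF that(2) u]]])
  have A_N: "A p (?N X Y p) (u p) = D X (form_apply A Y u) p" if "X \<in> ?X" "Y \<in> ?X" for X Y p
    using FG[OF S[OF D_sec[OF that(1) A_sec[OF that(2) u]]]] by (simp add: N_eq F_apply)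
  have A_fun_add: "form_apply A (X + Y) u = form_apply A X u + form_apply A Y u"
    if "X \<in> ?X" "Y \<in> ?X" for X Y
    using linear_map_on_add[OF A_lin2[OF up] T[OF that(1)] T[OF that(2)]]
    by (simp add: form_apply_def fun_eq_iff)
  have A_fun_scale: "form_apply A (\<lambda>p. f p *\<^sub>R X p) u = (\<lambda>p. f p *\<^sub>R form_apply A X u p)"
    if "X \<in> ?X" for f X
    using linear_map_on_scaleR[OF A_lin2[OF up] T[OF that]]
    by (simp add: form_apply_def fun_eq_iff)
  have N_conn: "connection M ?X ?N"
    unfolding connection_def
  proof (intro conjI ballI)
    fix X Y Z assume XYZ: "X \<in> ?X" "Y \<in> ?X" "Z \<in> ?X"
    note s = D_sec[OF _ A_sec[OF _ u]]
    have "D (X + Y) (form_apply A Z u) = D X (form_apply A Z u) + D Y (form_apply A Z u)"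
      using conn XYZ A_sec[OF XYZ(3) u] unfolding connection_def by blast
    then show "?N (X + Y) Z = ?N X Z + ?N Y Z"
      by (simp add: N_eq fun_eq_iff linear_map_on_add[OF G_lin S[OF s] S[OF s]] XYZ)
    have "D X (form_apply A Y u + form_apply A Z u) = D X (form_apply A Y u) + D X (form_apply A Z u)"
      using conn XYZ A_sec[OF XYZ(3) u] A_sec[OF XYZ(2) u] unfolding connection_def by blast
    then show "?N X (Y + Z) = ?N X Y + ?N X Z"
      by (simp add: N_eq A_fun_add fun_eq_iff linear_map_on_add[OF G_lin S[OF s] S[OF s]] XYZ)
  next
    fix f X Y assume f: "f \<in> smooth_functions M" and XY: "X \<in> ?X" "Y \<in> ?X"
    let ?s = "form_apply A Y u"
    note s = A_sec[OF XY(2) u]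
    note Ds = D_sec[OF XY(1) s]
    have "D (\<lambda>p. f p *\<^sub>R X p) ?s = (\<lambda>p. f p *\<^sub>R D X ?s p)"
      using conn XY f s by (simp add: connection_def)
    then show "?N (\<lambda>p. f p *\<^sub>R X p) Y = (\<lambda>p. f p *\<^sub>R ?N X Y p)"
      by (simp add: N_eq linear_map_on_scaleR[OF G_lin S[OF Ds]])
    have "D X (\<lambda>p. f p *\<^sub>R ?s p) = (\<lambda>p. X p f *\<^sub>R ?s p + f p *\<^sub>R D X ?s p)"
      using conn XY f s by (simp add: connection_def)
    \<comment> \<open>Here \<open>a\<close> and \<open>b\<close> stand for the values of
      \<open>X p f\<close> and \<open>f p\<close>. The inverse of \<open>F\<close> takes
      \<open>?s\<close> back to \<open>Y\<close>, which gives the Leibniz rule on the tangent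
      bundle.\<close>
    moreover have "?G p (a *\<^sub>R ?s p + b *\<^sub>R D X ?s p) = a *\<^sub>R Y p + b *\<^sub>R ?G p (D X ?s p)" for p a b
    proof -
      have "?G p (?s p) = Y p" using GF[OF T[OF XY(2)]] by (simp add: form_apply_def F_apply)
      then show ?thesis
        using linear_map_on_add[OF G_lin subspace_scale[OF subV S[OF s]] subspace_scale[OF subV S[OF Ds]]]
          linear_map_on_scaleR[OF G_lin S[OF s]] linear_map_on_scaleR[OF G_lin S[OF Ds]]
        by simp
    qed
    ultimately show "?N X (\<lambda>p. f p *\<^sub>R Y p) = (\<lambda>p. X p f *\<^sub>R Y p + f p *\<^sub>R ?N X Y p)"
      by (simp add: N_eq A_fun_scale[OF XY(2)])
  qed (rule N_mem)

  \<comment> \<open>Vanishing of the torsion\<close>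
  have bracket: "lie_bracket X Y \<in> ?X" if "X \<in> ?X" "Y \<in> ?X" for X Y
    by (rule lie_bracket_vector_fields[OF M that])
  \<comment> \<open>Used with \<open>s\<close> equal to \<open>u\<close> for the torsion and to
    \<open>form_apply A Z u\<close> for compatibility.\<close>
  have flat: "D X (form_apply A Y s) p - A p (Y p) (D X s p)
      - (D Y (form_apply A X s) p - A p (X p) (D Y s p)) - A p (lie_bracket X Y p) (s p) = 0"
    if "X \<in> ?X" "Y \<in> ?X" "s \<in> ?\<Gamma>" for X Y s p
  proof -
    have "ext_cov_derivative D A X Y s = 0" using assms(5) that by blast
    from fun_cong[OF this, of p] show ?thesis
      by (simp add: ext_cov_derivative_def End_connection_def form_apply_def)
  qed
  have tors: "D X (form_apply A Y u) p - D Y (form_apply A X u) p = A p (lie_bracket X Y p) (u p)"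
    if "X \<in> ?X" "Y \<in> ?X" for X Y p
  proof -
    \<comment> \<open>The symmetry condition on the derivative of \<open>u\<close> cancels the two
      terms of \<open>flat\<close> in which \<open>D\<close> acts on \<open>u\<close>
      itself.\<close>
    have "form_apply A Y (D X u) = form_apply A X (D Y u)" using assms(8) that by blast
    from fun_cong[OF this, of p] show ?thesis
      using flat[OF that u, of p] by (simp add: form_apply_def)
  qed
  have N_tors: "torsion_free M ?N"
    unfolding torsion_free_def
  proof (intro ballI)
    fix X Y assume XY: "X \<in> ?X" "Y \<in> ?X"
    have "?N X Y p - ?N Y X p = lie_bracket X Y p" for p
    proof (rule F_inj)
      note n = T[OF N_mem[OF XY]] T[OF N_mem[OF XY(2,1)]]
      show "F p (?N X Y p - ?N Y X p) = F p (lie_bracket X Y p)"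
        using tors[OF XY] linear_map_on_diff[OF F(1) subT n]
        by (simp add: F_apply A_N XY)
      show "?N X Y p - ?N Y X p \<in> ?T p" by (rule subspace_diff[OF subT n])
      show "lie_bracket X Y p \<in> ?T p" by (rule T[OF bracket[OF XY]])
    qed
    then show "?N X Y - ?N Y X - lie_bracket X Y = 0" by (simp add: fun_eq_iff)
  qed

  \<comment> \<open>Compatibility with the multiplication\<close>
  let ?C = "connection_deriv_mult ?N mult"
  have m_fun: "field_mult mult X Y \<in> ?X" if "X \<in> ?X" "Y \<in> ?X" for X Y
    using m_field[OF that] by (simp add: field_mult_def)
  have A_m_fun: "form_apply A (field_mult mult X Y) u = form_apply A X (form_apply A Y u)"
    if "X \<in> ?X" "Y \<in> ?X" for X Y
    using A_m_u[OF T[OF that(1)] T[OF that(2)]] by (simp add: form_apply_def field_mult_def)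
  have C_mem: "?C X Y Z \<in> ?X" if "X \<in> ?X" "Y \<in> ?X" "Z \<in> ?X" for X Y Z
    unfolding connection_deriv_mult_def
    by (intro vector_fields_diff[OF M] N_mem m_fun that)
  have F_C: "F p (?C X Y Z p) = D X (form_apply A Y (form_apply A Z u)) p
      - A p (Z p) (D X (form_apply A Y u) p) - A p (Y p) (D X (form_apply A Z u) p)"
    if XYZ: "X \<in> ?X" "Y \<in> ?X" "Z \<in> ?X" for X Y Z p
  proof -
    let ?a = "?N X (field_mult mult Y Z)" and ?b = "field_mult mult (?N X Y) Z"
      and ?c = "field_mult mult Y (?N X Z)"
    have mem: "?a \<in> ?X" "?b \<in> ?X" "?c \<in> ?X"
      by (intro N_mem m_fun XYZ)+
    have "F p (?C X Y Z p) = F p (?a p) - F p (?b p) - F p (?c p)"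
      unfolding connection_deriv_mult_def
      using linear_map_on_diff[OF F(1) subT subspace_diff[OF subT T[OF mem(1)] T[OF mem(2)]] T[OF mem(3)]]
        linear_map_on_diff[OF F(1) subT T[OF mem(1)] T[OF mem(2)]] by simp
    moreover have "F p (?a p) = D X (form_apply A Y (form_apply A Z u)) p"
      by (simp only: F_apply A_N[OF XYZ(1) m_fun[OF XYZ(2,3)]] A_m_fun[OF XYZ(2,3)])
    \<comment> \<open>The two endomorphisms are interchanged so that the one of
      \<open>?N X Y\<close> meets \<open>u\<close>, where \<open>A_N\<close> evaluates it.\<close>
    moreover have "F p (?b p) = A p (Z p) (D X (form_apply A Y u) p)"
      by (simp only: F_apply field_mult_def A_m_u[OF T[OF N_mem[OF XYZ(1,2)]] T[OF XYZ(3)]]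
          A_comm[OF T[OF N_mem[OF XYZ(1,2)]] T[OF XYZ(3)] up] A_N[OF XYZ(1,2)])
    moreover have "F p (?c p) = A p (Y p) (D X (form_apply A Z u) p)"
      by (simp only: F_apply field_mult_def A_m_u[OF T[OF XYZ(2)] T[OF N_mem[OF XYZ(1,3)]]]
          A_N[OF XYZ(1,3)])
    ultimately show ?thesis by simp
  qed
  have C_sym: "?C X Y Z = ?C Y X Z" "?C X Y Z = ?C X Z Y"
    if XYZ: "X \<in> ?X" "Y \<in> ?X" "Z \<in> ?X" for X Y Z
  proof -
    have comm_u: "form_apply A Y' (form_apply A Z' u) = form_apply A Z' (form_apply A Y' u)"
      if "Y' \<in> ?X" "Z' \<in> ?X" for Y' Z'
      using assms(6) that u by blast
    \<comment> \<open>In \<open>F_C\<close> the last two terms are exchanged, and the first is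
      symmetric by commutation at \<open>u\<close>.\<close>
    show "?C X Y Z = ?C X Z Y"
    proof
      show "?C X Y Z p = ?C X Z Y p" for p
        by (rule F_inj[OF _ T[OF C_mem] T[OF C_mem]])
           (simp_all add: F_C XYZ comm_u[OF XYZ(2,3)])
    qed
    show "?C X Y Z = ?C Y X Z"
    proof
      fix p
      let ?s = "form_apply A Z u"
      \<comment> \<open>After exchanging \<open>X\<close> and \<open>Y\<close> in
        \<open>F_C\<close>, the terms with \<open>A p (Z p)\<close> in front differ by this amount.
        By \<open>flat\<close> at \<open>?s\<close> the other terms differ by the bracket
        endomorphism applied to \<open>?s\<close>, and commutation makes the two differences
        cancel.\<close>
      have "A p (Z p) (D X (form_apply A Y u) p) - A p (Z p) (D Y (form_apply A X u) p) =
          A p (Z p) (A p (lie_bracket X Y p) (u p))"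
        using linear_map_on_diff[OF A_lin[OF T[OF XYZ(3)]] subV
            S[OF D_sec[OF XYZ(1) A_sec[OF XYZ(2) u]]] S[OF D_sec[OF XYZ(2) A_sec[OF XYZ(1) u]]]]
        by (simp add: tors[OF XYZ(1,2)])
      also have "\<dots> = A p (lie_bracket X Y p) (?s p)"
        by (simp only: form_apply_def A_comm[OF T[OF XYZ(3)] T[OF bracket[OF XYZ(1,2)]] up])
      finally have "F p (?C X Y Z p) = F p (?C Y X Z p)"
        using flat[OF XYZ(1,2) A_sec[OF XYZ(3) u], of p]
        by (simp add: F_C XYZ algebra_simps)
      then show "?C X Y Z p = ?C Y X Z p"
        by (rule F_inj[OF _ T[OF C_mem] T[OF C_mem]]) (simp_all add: XYZ)
    qed
  qed
  have N_comp: "compatible_connection M ?N mult"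
    unfolding compatible_connection_def using C_sym by simp
  show ?thesis
    using tm cm am um N_conn N_tors N_comp
      F_manifold_if_compatible_connection[OF M tm cm am um N_conn N_tors N_comp]
    by simp
qed

end
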